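(* Let $\mathcal{Q}:\varphi$ be an SSAT formula with $\varphi$ in conjunctive normal form containing only non-tautological clauses. If $Pr(\mathcal{Q}:\varphi) = p$, then the empty clause $\emptyset^p$ is derivable from $\mathcal{Q}:\varphi$ by S-resolution.
   Context: An SSAT formula is $\mathcal{Q} : \varphi$ where $\mathcal{Q} = Q_1x_1\ldots Q_nx_n$ is a prefix of quantified propositional variables, each $Q_i$ being either $\exists$ or a randomized quantifier $\mathsf{R}^{p_i}$ with rational $0<p_i<1$, and $\varphi$ is a propositional formula with $\mathrm{Var}(\varphi)\subseteq\{x_1,\dots,x_n\}$. Its maximum probability of satisfaction is defined recursively: $Pr(\varepsilon:\varphi)$ is $0$ if $\varphi$ is equivalent to false and $1$ if equivalent to true; $Pr(\exists x\,\mathcal{Q}':\varphi) = \max(Pr(\mathcal{Q}':\varphi[\mathrm{true}/x]),Pr(\mathcal{Q}':\varphi[\mathrm{false}/x]))$; $Pr(\mathsf{R}^p x\,\mathcal{Q}':\varphi) = p\,Pr(\mathcal{Q}':\varphi[\mathrm{true}/x]) + (1-p)\,Pr(\mathcal{Q}':\varphi[\mathrm{false}/x])$. A clause is a disjunction (identified with a set) of literals without repetitions; it is tautological if it is valid. For $\psi$ with variables among $x_1,\dots,x_n$, $\mathcal{Q}(\psi)$ is the shortest prefix $Q_1x_1\ldots Q_ix_i$ of $\mathcal{Q}$ containing all variables of $\psi$. For a non-tautological clause $c$, $\mathrm{ff}_c$ is the unique assignment on $\mathrm{Var}(c)$ falsifying $c$. S-resolution derives annotated clauses $c^p$ ($0\le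 p\le1$) by the rules: (R.1) for every clause $c$ of $\varphi$, derive $c^0$. (R.2) if $c$ is a non-tautological clause over literals of variables in $\mathrm{Var}(\varphi)$, $\mathcal{Q}(c) = Q_1x_1\ldots Q_ix_i$, and for every $\tau:\{x_1,\dots,x_i\}\to\{\mathrm{true},\mathrm{false}\}$ agreeing with $\mathrm{ff}_c$ on $\mathrm{Var}(c)$ the formula $\varphi[\tau(x_1)/x_1]\ldots[\tau(x_i)/x_i]$ is valid, derive $c^1$. (R.3) from derived $(c_1\vee\neg x)^{p_1}$ and $(c_2\vee x)^{p_2}$, where $Qx$ occurs in $\mathcal{Q}$ but not in $\mathcal{Q}(c_1\vee c_2)$ and $c_1\vee c_2$ is non-tautological, derive $(c_1\vee c_2)^p$ with $p=\max(p_1,p_2)$ if $Q=\exists$ and $p = p_x p_1 + (1-p_x)p_2$ if $Q = \mathsf{R}^{p_x}$. *)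

theory Defs
  imports Complex_Main "HOL-Library.FuncSet"
begin

datatype 'v form =
    FFalse
  | FTrue
  | FVar 'v
  | FNot "'v form"
  | FAnd "'v form" "'v form"
  | FOr "'v form" "'v form"

primrec eval :: "('v \<Rightarrow> bool) \<Rightarrow> 'v form \<Rightarrow> bool" where
  "eval \<sigma> FFalse \<longleftrightarrow> False"
| "eval \<sigma> FTrue \<longleftrightarrow> True"
| "eval \<sigma> (FVar x) \<longleftrightarrow> \<sigma> x"
| "eval \<sigma> (FNot f) \<longleftrightarrow> \<not> eval \<sigma> f"
| "eval \<sigma> (FAnd f g) \<longleftrightarrow> eval \<sigma> f \<and> eval \<sigma> g"
| "eval \<sigma> (FOr f g) \<longleftrightarrow> eval \<sigma> f \<or> eval \<sigma> g"

definition valid :: "'v form \<Rightarrow> bool" where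
  "valid f \<longleftrightarrow> (\<forall>\<sigma>. eval \<sigma> f)"

definition equivalent :: "'v form \<Rightarrow> 'v form \<Rightarrow> bool" where
  "equivalent f g \<longleftrightarrow> (\<forall>\<sigma>. eval \<sigma> f = eval \<sigma> g)"

primrec vars :: "'v form \<Rightarrow> 'v set" where
  "vars FFalse = {}"
| "vars FTrue = {}"
| "vars (FVar x) = {x}"
| "vars (FNot f) = vars f"
| "vars (FAnd f g) = vars f \<union> vars g"
| "vars (FOr f g) = vars f \<union> vars g"

primrec subst :: "'v \<Rightarrow> bool \<Rightarrow> 'v form \<Rightarrow> 'v form" where
  "subst x b FFalse = FFalse"
| "subst x b FTrue = FTrue"
| "subst x b (FVar y) = (if y = x then (if b then FTrue else FFalse) else FVar y)"
| "subst x b (FNot f) = FNot (subst x b f)"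
| "subst x b (FAnd f g) = FAnd (subst x b f) (subst x b g)"
| "subst x b (FOr f g) = FOr (subst x b f) (subst x b g)"

definition substs :: "'v list \<Rightarrow> ('v \<Rightarrow> bool) \<Rightarrow> 'v form \<Rightarrow> 'v form" where
  "substs xs \<tau> f = fold (\<lambda>x g. subst x (\<tau> x) g) xs f"

datatype quantifier = Exists | Rand real

type_synonym 'v prefix = "(quantifier \<times> 'v) list"

definition prefix_vars :: "'v prefix \<Rightarrow> 'v set" where
  "prefix_vars Q = snd ` set Q"

definition ssat_formula :: "'v prefix \<Rightarrow> 'v form \<Rightarrow> bool" where
  "ssat_formula Q \<phi> \<longleftrightarrow>
     distinct (map snd Q) \<and>
     (\<forall>p x. (Rand p, x) \<in> set Q \<longrightarrow> p \<in> \<rat> \<and> 0 < p \<and> p < 1) \<and>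
     vars \<phi> \<subseteq> prefix_vars Q"

text \<open>For an SSAT formula the matrix is variable-free once the prefix is
  exhausted, so the \<open>undefined\<close> branch of the base case is never reached.\<close>

fun ssat_prob :: "'v prefix \<Rightarrow> 'v form \<Rightarrow> real" where
  "ssat_prob [] \<phi> =
     (if equivalent \<phi> FFalse then 0 else if equivalent \<phi> FTrue then 1 else undefined)"
| "ssat_prob ((Exists, x) # Q) \<phi> =
     max (ssat_prob Q (subst x True \<phi>)) (ssat_prob Q (subst x False \<phi>))"
| "ssat_prob ((Rand p, x) # Q) \<phi> =
     p * ssat_prob Q (subst x True \<phi>) + (1 - p) * ssat_prob Q (subst x False \<phi>)"

datatype 'v literal = Pos 'v | Neg 'v

type_synonym 'v clause = "'v literal set"

primrec lit_var :: "'v literal \<Rightarrow> 'v" where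
  "lit_var (Pos x) = x"
| "lit_var (Neg x) = x"

primrec lit_true :: "('v \<Rightarrow> bool) \<Rightarrow> 'v literal \<Rightarrow> bool" where
  "lit_true \<sigma> (Pos x) \<longleftrightarrow> \<sigma> x"
| "lit_true \<sigma> (Neg x) \<longleftrightarrow> \<not> \<sigma> x"

definition clause_true :: "('v \<Rightarrow> bool) \<Rightarrow> 'v clause \<Rightarrow> bool" where
  "clause_true \<sigma> c \<longleftrightarrow> (\<exists>l\<in>c. lit_true \<sigma> l)"

definition clause_vars :: "'v clause \<Rightarrow> 'v set" where
  "clause_vars c = lit_var ` c"

definition tautological :: "'v clause \<Rightarrow> bool" where
  "tautological c \<longleftrightarrow> (\<forall>\<sigma>. clause_true \<sigma> c)"

text \<open>Conjunctive normal form is a syntactic condition on formulas, up to the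
  bracketing of \<open>FAnd\<close> and \<open>FOr\<close>. The empty clause is \<open>FFalse\<close> and the empty
  conjunction is \<open>FTrue\<close>; neither is allowed inside a proper disjunction,
  nor \<open>FTrue\<close> inside a proper conjunction. The functions \<open>form_lits\<close> and
  \<open>form_clauses\<close> are meaningful only on formulas satisfying \<open>is_clause\<close> and
  \<open>is_cnf\<close>, respectively.\<close>

fun form_lits :: "'v form \<Rightarrow> 'v clause" where
  "form_lits (FVar x) = {Pos x}"
| "form_lits (FNot (FVar x)) = {Neg x}"
| "form_lits (FOr f g) = form_lits f \<union> form_lits g"
| "form_lits _ = {}"

fun is_disj :: "'v form \<Rightarrow> bool" where
  "is_disj (FVar x) \<longleftrightarrow> True"
| "is_disj (FNot (FVar x)) \<longleftrightarrow> True"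
| "is_disj (FOr f g) \<longleftrightarrow> is_disj f \<and> is_disj g \<and> form_lits f \<inter> form_lits g = {}"
| "is_disj _ \<longleftrightarrow> False"

definition is_clause :: "'v form \<Rightarrow> bool" where
  "is_clause f \<longleftrightarrow> f = FFalse \<or> is_disj f"

fun is_conj :: "'v form \<Rightarrow> bool" where
  "is_conj (FAnd f g) \<longleftrightarrow> is_conj f \<and> is_conj g"
| "is_conj f \<longleftrightarrow> is_clause f"

definition is_cnf :: "'v form \<Rightarrow> bool" where
  "is_cnf f \<longleftrightarrow> f = FTrue \<or> is_conj f"

fun form_clauses :: "'v form \<Rightarrow> 'v clause set" where
  "form_clauses (FAnd f g) = form_clauses f \<union> form_clauses g"
| "form_clauses FTrue = {}"
| "form_clauses f = {form_lits f}"

lemma eval_is_disj: "is_disj f \<Longrightarrow> eval \<sigma> f \<longleftrightarrow> clause_true \<sigma> (form_lits f)"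
  by (induction f rule: is_disj.induct) (auto simp: clause_true_def)

lemma eval_is_clause: "is_clause f \<Longrightarrow> eval \<sigma> f \<longleftrightarrow> clause_true \<sigma> (form_lits f)"
  by (auto simp: is_clause_def eval_is_disj) (simp add: clause_true_def)

lemma eval_is_conj: "is_conj f \<Longrightarrow> eval \<sigma> f \<longleftrightarrow> (\<forall>c\<in>form_clauses f. clause_true \<sigma> c)"
proof (induction f)
  case FTrue
  then show ?case by simp
next
  case (FAnd f g)
  then show ?case by auto
qed (use eval_is_clause in \<open>force+\<close>)

lemma eval_is_cnf: "is_cnf f \<Longrightarrow> eval \<sigma> f \<longleftrightarrow> (\<forall>c\<in>form_clauses f. clause_true \<sigma> c)"
  by (auto simp: is_cnf_def eval_is_conj)

text \<open>The partial assignment \<open>ff c\<close> on the variables of \<open>c\<close> is an extensional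
  function. It is well defined only if \<open>c\<close> is non-tautological.\<close>

definition ff :: "'v clause \<Rightarrow> 'v \<Rightarrow> bool" where
  "ff c = (THE \<tau>. \<tau> \<in> extensional (clause_vars c) \<and> \<not> clause_true \<tau> c)"

lemma ff_ex1:
  assumes "\<not> tautological c"
  shows "\<exists>!\<tau>. \<tau> \<in> extensional (clause_vars c) \<and> \<not> clause_true \<tau> c"
proof -
  from assms obtain \<sigma> where \<sigma>: "\<not> clause_true \<sigma> c"
    by (auto simp: tautological_def)
  have restr: "lit_true (restrict \<sigma> (clause_vars c)) l = lit_true \<sigma> l" if "l \<in> c" for l
    using that by (cases l) (force simp: clause_vars_def)+
  show ?thesis
  proof (rule ex1I)
    show "restrict \<sigma> (clause_vars c) \<in> extensional (clause_vars c) \<and>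
        \<not> clause_true (restrict \<sigma> (clause_vars c)) c"
      using \<sigma> restr by (simp add: clause_true_def)
  next
    fix \<tau> assume \<tau>: "\<tau> \<in> extensional (clause_vars c) \<and> \<not> clause_true \<tau> c"
    show "\<tau> = restrict \<sigma> (clause_vars c)"
    proof (rule extensionalityI)
      fix x assume x: "x \<in> clause_vars c"
      then obtain l where l: "l \<in> c" "lit_var l = x"
        by (auto simp: clause_vars_def)
      then have "\<not> lit_true \<tau> l" "\<not> lit_true \<sigma> l"
        using \<tau> \<sigma> by (auto simp: clause_true_def)
      then show "\<tau> x = restrict \<sigma> (clause_vars c) x"
        using l x by (cases l) auto
    qed (use \<tau> in auto)
  qed
qed

text \<open>The prefix \<open>\<Q>(\<psi>)\<close> depends on \<open>\<psi>\<close> only through its set of variables \<open>V\<close>.\<close>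

definition shortest_prefix :: "'v prefix \<Rightarrow> 'v set \<Rightarrow> 'v prefix" where
  "shortest_prefix Q V = take (LEAST i. V \<subseteq> prefix_vars (take i Q)) Q"

primrec combine :: "quantifier \<Rightarrow> real \<Rightarrow> real \<Rightarrow> real" where
  "combine Exists p1 p2 = max p1 p2"
| "combine (Rand r) p1 p2 = r * p1 + (1 - r) * p2"

text \<open>In rule \<open>R2\<close>, \<open>\<tau>\<close> is a total function, but only its values on the variables
  of \<open>shortest_prefix Q (clause_vars c)\<close> matter. In rule \<open>R3\<close>, the premise on
  \<open>shortest_prefix\<close> excludes \<open>x\<close> from the variables of \<open>c1 \<union> c2\<close>, so \<open>insert\<close>
  always adds a new literal.\<close>

inductive s_resolution :: "'v prefix \<Rightarrow> 'v form \<Rightarrow> 'v clause \<Rightarrow> real \<Rightarrow> bool"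
  for Q :: "'v prefix" and \<phi> :: "'v form" where
  R1: "c \<in> form_clauses \<phi> \<Longrightarrow> s_resolution Q \<phi> c 0"
| R2: "\<not> tautological c \<Longrightarrow> clause_vars c \<subseteq> vars \<phi> \<Longrightarrow>
    (\<And>\<tau>. (\<forall>x\<in>clause_vars c. \<tau> x = ff c x) \<Longrightarrow>
       valid (substs (map snd (shortest_prefix Q (clause_vars c))) \<tau> \<phi>)) \<Longrightarrow>
    s_resolution Q \<phi> c 1"
| R3: "s_resolution Q \<phi> (insert (Neg x) c1) p1 \<Longrightarrow>
    s_resolution Q \<phi> (insert (Pos x) c2) p2 \<Longrightarrow>
    (q, x) \<in> set Q \<Longrightarrow>
    (q, x) \<notin> set (shortest_prefix Q (clause_vars (c1 \<union> c2))) \<Longrightarrow>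
    \<not> tautological (c1 \<union> c2) \<Longrightarrow>
    s_resolution Q \<phi> (c1 \<union> c2) (combine q p1 p2)"

end

theory Submission imports Defs begin

text \<open>Induct on the quantifiers still to be resolved, from the innermost one outwards. For every
  assignment \<open>\<tau>\<close> of the outer variables one derives a clause over these variables that is
  falsified by \<open>\<tau>\<close>, annotated with the probability of the remaining formula under \<open>\<tau>\<close>. The
  invariant also demands that this probability be the same for \<^emph>\<open>every\<close> assignment falsifying the
  clause. Hence, if one of the two clauses obtained for \<open>x = true\<close> and \<open>x = false\<close> does not mention
  \<open>x\<close>, the two probabilities agree and that clause already serves one level further out; otherwise
  the two clauses are resolved on \<open>x\<close>.\<close>

section \<open>Evaluation of formulas under substitution\<close>

lemma eval_cong: "(\<And>x. x \<in> vars f \<Longrightarrow> \<sigma> x = \<tau> x) \<Longrightarrow> eval \<sigma> f = eval \<tau> f"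
  by (induction f) auto

lemma eval_subst: "eval \<sigma> (subst x b f) = eval (\<sigma>(x := b)) f"
  by (induction f) auto

lemma eval_substs: "eval \<sigma> (substs xs \<tau> f) = eval (\<lambda>x. if x \<in> set xs then \<tau> x else \<sigma> x) f"
proof (induction xs arbitrary: f)
  case Nil
  then show ?case by (simp add: substs_def)
next
  case (Cons x xs)
  have "eval \<sigma> (substs (x # xs) \<tau> f) = eval \<sigma> (substs xs \<tau> (subst x (\<tau> x) f))"
    by (simp add: substs_def)
  also have "\<dots> = eval ((\<lambda>y. if y \<in> set xs then \<tau> y else \<sigma> y)(x := \<tau> x)) f"
    by (simp add: Cons.IH eval_subst)
  also have "\<dots> = eval (\<lambda>y. if y \<in> set (x # xs) then \<tau> y else \<sigma> y) f"
    by (rule eval_cong) simp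
  finally show ?case .
qed

lemma eval_substs_closed:
  "vars f \<subseteq> set xs \<Longrightarrow> eval \<sigma> (substs xs \<tau> f) = eval \<tau> f"
  unfolding eval_substs by (rule eval_cong) auto

lemma substs_cong: "(\<And>x. x \<in> set xs \<Longrightarrow> \<sigma> x = \<tau> x) \<Longrightarrow> substs xs \<sigma> f = substs xs \<tau> f"
  unfolding substs_def by (rule fold_cong) auto

text \<open>Freshness of \<open>x\<close> keeps the update of \<open>\<tau>\<close> invisible to the
  earlier substitutions. This moves one quantified variable from the remaining prefix to the
  assigned one.\<close>

lemma substs_snoc:
  assumes "x \<notin> set xs"
  shows "substs (xs @ [x]) (\<tau>(x := b)) f = subst x b (substs xs \<tau> f)"
proof -
  have "substs xs (\<tau>(x := b)) f = substs xs \<tau> f"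
    using assms by (intro substs_cong) auto
  then show ?thesis
    unfolding substs_def by simp
qed

section \<open>Variables of clauses and the recursion for the probability\<close>

lemma form_lits_vars: "clause_vars (form_lits f) \<subseteq> vars f"
  by (induction f rule: form_lits.induct) (auto simp: clause_vars_def)

lemma form_clauses_vars: "c \<in> form_clauses f \<Longrightarrow> clause_vars c \<subseteq> vars f"
proof (induction f)
  case (FAnd f g)
  then show ?case by auto
qed (metis form_lits_vars form_clauses.simps singletonD empty_iff)+

text \<open>Once every variable is replaced, the truth value no longer depends on an assignment, so
  one of the two defined cases of the base equation applies.\<close>

lemma ssat_prob_Nil_substs:
  "vars f \<subseteq> set xs \<Longrightarrow> ssat_prob [] (substs xs \<tau> f) = (if eval \<tau> f then 1 else 0)"
  by (simp add: equivalent_def eval_substs_closed)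

lemma ssat_prob_Cons:
  "ssat_prob ((q, x) # Q) f
    = combine q (ssat_prob Q (subst x True f)) (ssat_prob Q (subst x False f))"
  by (cases q) auto

lemma combine_idem [simp]: "combine q p p = p"
  by (cases q) (auto simp: algebra_simps)

section \<open>Truth of clauses and falsifying assignments\<close>

lemma clause_true_cong:
  assumes "\<And>x. x \<in> clause_vars c \<Longrightarrow> \<sigma> x = \<tau> x"
  shows "clause_true \<sigma> c = clause_true \<tau> c"
proof -
  have "lit_true \<sigma> l = lit_true \<tau> l" if "l \<in> c" for l
    using assms[of "lit_var l"] that by (cases l) (simp_all add: clause_vars_def rev_image_eqI)
  then show ?thesis by (auto simp: clause_true_def)
qed

text \<open>Uniqueness of the falsifying partial assignment lets any total falsifying
  \<open>\<tau>\<close> stand in for the definite description.\<close>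

lemma ff_eq_restrict:
  assumes "\<not> clause_true \<tau> c"
  shows "ff c = restrict \<tau> (clause_vars c)"
proof -
  have "\<not> tautological c"
    using assms by (auto simp: tautological_def)
  moreover have "\<not> clause_true (restrict \<tau> (clause_vars c)) c"
    using assms clause_true_cong[of c "restrict \<tau> (clause_vars c)" \<tau>] by simp
  ultimately show ?thesis
    unfolding ff_def using ff_ex1 by (intro the1_equality) auto
qed

section \<open>Shortest prefixes\<close>

lemma subset_prefix_vars_shortest_prefix:
  assumes "V \<subseteq> prefix_vars Q"
  shows "V \<subseteq> prefix_vars (shortest_prefix Q V)"
  unfolding shortest_prefix_def by (rule LeastI[of _ "length Q"]) (use assms in simp)

text \<open>The prefix \<open>P\<close> itself competes for the least length, so nothing from
  \<open>R\<close> is reached. This supplies the side condition of \<open>R3\<close>.\<close>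

lemma set_shortest_prefix_append:
  assumes "V \<subseteq> prefix_vars P"
  shows "set (shortest_prefix (P @ R) V) \<subseteq> set P"
proof -
  define k where "k = (LEAST i. V \<subseteq> prefix_vars (take i (P @ R)))"
  have "k \<le> length P"
    unfolding k_def by (rule Least_le) (use assms in simp)
  then have "shortest_prefix (P @ R) V = take k P"
    unfolding shortest_prefix_def k_def[symmetric] by simp
  then show ?thesis
    by (simp add: set_take_subset)
qed

section \<open>Clauses falsified by exactly one assignment of their variables\<close>

definition falsified_clause :: "'v set \<Rightarrow> ('v \<Rightarrow> bool) \<Rightarrow> 'v clause" where
  "falsified_clause V \<tau> = (\<lambda>x. if \<tau> x then Neg x else Pos x) ` V"

lemma clause_vars_falsified_clause [simp]:
  fixes V :: "'v set"
  shows "clause_vars (falsified_clause V \<tau>) = V"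
proof -
  have "lit_var (if b then Neg x else Pos x) = x" for b and x :: 'v
    by simp
  then show ?thesis
    by (simp only: clause_vars_def falsified_clause_def image_image image_ident)
qed

lemma clause_true_falsified_clause:
  "clause_true \<sigma> (falsified_clause V \<tau>) \<longleftrightarrow> (\<exists>x\<in>V. \<sigma> x \<noteq> \<tau> x)"
proof -
  have "lit_true \<sigma> (if \<tau> x then Neg x else Pos x) \<longleftrightarrow> \<sigma> x \<noteq> \<tau> x" for x
    by simp
  then show ?thesis
    by (simp only: clause_true_def falsified_clause_def bex_simps)
qed

text \<open>Because the clause mentions all of \<open>vars \<phi>\<close>, any assignment extending
  its \<open>ff\<close> agrees with \<open>\<tau>\<close> there, and its shortest prefix covers the
  whole formula. The substituted formula is thus closed and true.\<close>

lemma s_resolution_falsified_clause: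
  assumes "vars \<phi> \<subseteq> prefix_vars Q" and "eval \<tau> \<phi>"
  shows "s_resolution Q \<phi> (falsified_clause (vars \<phi>) \<tau>) 1"
proof (rule R2)
  let ?c = "falsified_clause (vars \<phi>) \<tau>"
  have c: "\<not> clause_true \<tau> ?c"
    by (simp add: clause_true_falsified_clause)
  then show "\<not> tautological ?c"
    by (auto simp: tautological_def)
  show "clause_vars ?c \<subseteq> vars \<phi>" by simp
  fix \<rho> assume "\<forall>x\<in>clause_vars ?c. \<rho> x = ff ?c x"
  then have "eval \<rho> \<phi>"
    using assms(2) eval_cong[of \<phi> \<rho> \<tau>] by (simp add: ff_eq_restrict[OF c])
  moreover have "vars \<phi> \<subseteq> set (map snd (shortest_prefix Q (clause_vars ?c)))"
    using subset_prefix_vars_shortest_prefix[OF assms(1)] by (simp add: prefix_vars_def)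
  ultimately show "valid (substs (map snd (shortest_prefix Q (clause_vars ?c))) \<rho> \<phi>)"
    by (simp add: valid_def eval_substs_closed)
qed

section \<open>The induction over the remaining prefix\<close>

lemma s_resolution_restricted:
  assumes "distinct (map snd Q)" and "vars \<phi> \<subseteq> prefix_vars Q" and "is_cnf \<phi>"
    and "Q = P @ R"
  shows "\<exists>c. s_resolution Q \<phi> c (ssat_prob R (substs (map snd P) \<tau> \<phi>))
    \<and> \<not> clause_true \<tau> c \<and> clause_vars c \<subseteq> prefix_vars P
    \<and> (\<forall>\<sigma>. \<not> clause_true \<sigma> c \<longrightarrow>
          ssat_prob R (substs (map snd P) \<sigma> \<phi>) = ssat_prob R (substs (map snd P) \<tau> \<phi>))"
  using assms(4)
\<comment> \<open>\<open>P\<close> grows at its end as \<open>R\<close> loses its head, and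
  \<open>\<tau>\<close> changes at the variable that moves, so both are generalized.\<close>
proof (induction R arbitrary: P \<tau>)
  case Nil
  then have PQ: "P = Q" by simp
  have prob: "ssat_prob [] (substs (map snd Q) \<sigma> \<phi>) = (if eval \<sigma> \<phi> then 1 else 0)" for \<sigma>
    using assms(2) by (intro ssat_prob_Nil_substs) (simp add: prefix_vars_def)
  show ?case
  proof (cases "eval \<tau> \<phi>")
    case True
    have "eval \<sigma> \<phi>" if "\<not> clause_true \<sigma> (falsified_clause (vars \<phi>) \<tau>)" for \<sigma>
      using True that eval_cong[of \<phi> \<sigma> \<tau>] by (simp add: clause_true_falsified_clause)
    then show ?thesis
      using True s_resolution_falsified_clause[OF assms(2) True] assms(2)
      unfolding PQ prob
      by (intro exI[of _ "falsified_clause (vars \<phi>) \<tau>"]) (simp add: clause_true_falsified_clause)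
  next
    case False
    \<comment> \<open>A false conjunctive normal form has a false clause. Every assignment
      falsifying that clause refutes \<open>\<phi>\<close> too, which matches the annotation 0 of
      \<open>R1\<close>.\<close>
    then obtain c where c: "c \<in> form_clauses \<phi>" "\<not> clause_true \<tau> c"
      using eval_is_cnf[OF assms(3)] by blast
    have unsat: "\<not> eval \<sigma> \<phi>" if "\<not> clause_true \<sigma> c" for \<sigma>
      using that c(1) eval_is_cnf[OF assms(3)] by blast
    have "clause_vars c \<subseteq> vars \<phi>"
      using c(1) by (rule form_clauses_vars)
    then show ?thesis
      using False unsat c assms(2) R1[OF c(1), of Q] unfolding PQ prob by (intro exI[of _ c]) auto
  qed
next
  case (Cons a R)
  obtain q x where a: "a = (q, x)" by (cases a)
  let ?f = "\<lambda>\<sigma>. substs (map snd P) \<sigma> \<phi>"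
  let ?p = "\<lambda>b \<sigma>. ssat_prob R (subst x b (?f \<sigma>))"
  have Q: "Q = (P @ [(q, x)]) @ R" using Cons.prems a by simp
  have x: "x \<notin> prefix_vars P" "x \<notin> set (map snd P)"
    using assms(1) Q by (auto simp: prefix_vars_def)
  have snoc: "substs (map snd (P @ [(q, x)])) (\<sigma>(x := b)) \<phi> = subst x b (?f \<sigma>)" for \<sigma> b
    using substs_snoc[OF x(2)] by simp
  have prob: "ssat_prob (a # R) (?f \<sigma>) = combine q (?p True \<sigma>) (?p False \<sigma>)" for \<sigma>
    by (simp add: a ssat_prob_Cons)
  \<comment> \<open>The value \<open>d\<close> is independent of \<open>b\<close>: a clause found
    for \<open>x = b\<close> may also be falsified with \<open>x\<close> set the other way, and then
    it fixes the probability of that branch too.\<close>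
  have branch: "\<exists>c. s_resolution Q \<phi> c (?p b \<tau>) \<and> \<not> clause_true (\<tau>(x := b)) c
      \<and> clause_vars c \<subseteq> insert x (prefix_vars P)
      \<and> (\<forall>\<sigma> d. \<not> clause_true (\<sigma>(x := d)) c \<longrightarrow> ?p d \<sigma> = ?p b \<tau>)" for b
  proof -
    obtain c where c: "s_resolution Q \<phi> c (?p b \<tau>)" "\<not> clause_true (\<tau>(x := b)) c"
        "clause_vars c \<subseteq> prefix_vars (P @ [(q, x)])"
        "\<And>\<sigma>. \<not> clause_true \<sigma> c \<Longrightarrow>
          ssat_prob R (substs (map snd (P @ [(q, x)])) \<sigma> \<phi>) = ?p b \<tau>"
      using Cons.IH[OF Q, of "\<tau>(x := b)"] unfolding snoc by blast
    have "?p d \<sigma> = ?p b \<tau>" if "\<not> clause_true (\<sigma>(x := d)) c" for \<sigma> d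
      using c(4)[OF that] unfolding snoc .
    moreover have "clause_vars c \<subseteq> insert x (prefix_vars P)"
      using c(3) by (simp add: prefix_vars_def)
    ultimately show ?thesis
      using c(1,2) by blast
  qed
  have independent: ?case
    if "s_resolution Q \<phi> c (?p b \<tau>)" "\<not> clause_true (\<tau>(x := b)) c"
      "clause_vars c \<subseteq> insert x (prefix_vars P)" "x \<notin> clause_vars c"
      "\<forall>\<sigma> d. \<not> clause_true (\<sigma>(x := d)) c \<longrightarrow> ?p d \<sigma> = ?p b \<tau>" for c b
  proof -
    have upd: "clause_true (\<sigma>(x := d)) c = clause_true \<sigma> c" for \<sigma> d
      using that(4) by (intro clause_true_cong) auto
    \<comment> \<open>As \<open>c\<close> ignores \<open>x\<close>, its invariant applies to both
      values of \<open>d\<close>; equal branches make the quantifier collapse by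
      \<open>combine_idem\<close>.\<close>
    have eq: "ssat_prob (a # R) (?f \<sigma>) = ?p b \<tau>" if "\<not> clause_true \<sigma> c" for \<sigma>
      using that \<open>\<forall>\<sigma> d. \<not> clause_true (\<sigma>(x := d)) c \<longrightarrow> ?p d \<sigma> = ?p b \<tau>\<close>
      by (simp add: prob upd)
    moreover have false: "\<not> clause_true \<tau> c"
      using that(2) by (simp only: upd not_False_eq_True)
    moreover have "clause_vars c \<subseteq> prefix_vars P"
      using that(3,4) by blast
    ultimately show ?case
      using that(1) unfolding eq[OF false] by blast
  qed
  obtain c1 where c1: "s_resolution Q \<phi> c1 (?p True \<tau>)" "\<not> clause_true (\<tau>(x := True)) c1"
      "clause_vars c1 \<subseteq> insert x (prefix_vars P)"
      "\<forall>\<sigma> d. \<not> clause_true (\<sigma>(x := d)) c1 \<longrightarrow> ?p d \<sigma> = ?p True \<tau>"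
    using branch[of True] by blast
  obtain c2 where c2: "s_resolution Q \<phi> c2 (?p False \<tau>)" "\<not> clause_true (\<tau>(x := False)) c2"
      "clause_vars c2 \<subseteq> insert x (prefix_vars P)"
      "\<forall>\<sigma> d. \<not> clause_true (\<sigma>(x := d)) c2 \<longrightarrow> ?p d \<sigma> = ?p False \<tau>"
    using branch[of False] by blast
  show ?case
  proof (cases "x \<in> clause_vars c1 \<and> x \<in> clause_vars c2")
    case False
    then show ?thesis
      using independent[OF c1(1-3) _ c1(4)] independent[OF c2(1-3) _ c2(4)] by blast
  next
    case True
    \<comment> \<open>A clause false at \<open>x = True\<close> cannot contain \<open>Pos x\<close>,
      so \<open>x\<close> enters \<open>c1\<close> only through \<open>Neg x\<close>; dually for
      \<open>c2\<close>.\<close>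
    have Pos: "Pos x \<notin> c1" and Neg: "Neg x \<notin> c2"
      using c1(2) c2(2) by (force simp: clause_true_def)+
    define d1 d2 where "d1 = c1 - {Neg x}" and "d2 = c2 - {Pos x}"
    have "l = Pos x \<or> l = Neg x" if "lit_var l = x" for l
      using that by (cases l) auto
    then have ins: "c1 = insert (Neg x) d1" "c2 = insert (Pos x) d2"
      and x_notin: "x \<notin> clause_vars (d1 \<union> d2)"
      using True Pos Neg by (force simp: clause_vars_def d1_def d2_def)+
    have upd: "clause_true (\<sigma>(x := b)) (d1 \<union> d2) = clause_true \<sigma> (d1 \<union> d2)" for \<sigma> b
      using x_notin by (intro clause_true_cong) auto
    \<comment> \<open>Setting \<open>x\<close> falsifies the literal that was removed, so whatever
      falsifies the resolvent falsifies each parent after the suitable update and inherits both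
      invariants.\<close>
    have false1: "\<not> clause_true (\<sigma>(x := True)) c1" and false2: "\<not> clause_true (\<sigma>(x := False)) c2"
      if "\<not> clause_true \<sigma> (d1 \<union> d2)" for \<sigma>
      using that upd[of \<sigma> True] upd[of \<sigma> False] by (auto simp: ins clause_true_def)
    \<comment> \<open>The two halves are known to be false under different updates of
      \<open>\<tau>\<close>; neither mentions \<open>x\<close>, so each update can be undone
      separately.\<close>
    have false: "\<not> clause_true \<tau> (d1 \<union> d2)"
    proof -
      have "\<not> clause_true \<tau> d" if "x \<notin> clause_vars d" "\<not> clause_true (\<tau>(x := b)) d" for d b
        using that clause_true_cong[of d "\<tau>(x := b)" \<tau>] by (metis fun_upd_other)
      from this[of d1 True] this[of d2 False] show ?thesis
        using c1(2) c2(2) x_notin by (auto simp: ins clause_true_def clause_vars_def)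
    qed
    have cv: "clause_vars (d1 \<union> d2) \<subseteq> prefix_vars P"
      using c1(3) c2(3) x_notin by (auto simp: ins clause_vars_def)
    have "s_resolution Q \<phi> (d1 \<union> d2) (ssat_prob (a # R) (?f \<tau>))"
      unfolding prob
    proof (rule R3)
      show "s_resolution Q \<phi> (insert (Neg x) d1) (?p True \<tau>)" using c1(1) ins by simp
      show "s_resolution Q \<phi> (insert (Pos x) d2) (?p False \<tau>)" using c2(1) ins by simp
      show "(q, x) \<in> set Q" using Q by simp
      show "(q, x) \<notin> set (shortest_prefix Q (clause_vars (d1 \<union> d2)))"
        using set_shortest_prefix_append[OF cv, of "a # R"] x Cons.prems
        by (force simp: prefix_vars_def)
      show "\<not> tautological (d1 \<union> d2)" using false by (auto simp: tautological_def)
    qed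
    moreover have "ssat_prob (a # R) (?f \<sigma>) = ssat_prob (a # R) (?f \<tau>)"
      if "\<not> clause_true \<sigma> (d1 \<union> d2)" for \<sigma>
    proof -
      have "?p True \<sigma> = ?p True \<tau>" "?p False \<sigma> = ?p False \<tau>"
        using c1(4) c2(4) false1[OF that] false2[OF that] by blast+
      then show ?thesis by (simp only: prob)
    qed
    ultimately show ?thesis
      using false cv by blast
  qed
qed

theorem theorem3p3:
  fixes Q :: "'v prefix" and \<phi> :: "'v form" and p :: real
  assumes "ssat_formula Q \<phi>"
    and "is_cnf \<phi>"
    and "\<And>c. c \<in> form_clauses \<phi> \<Longrightarrow> \<not> tautological c"
    and "ssat_prob Q \<phi> = p"
  shows "s_resolution Q \<phi> {} p"
proof -
  have Q: "distinct (map snd Q)" "vars \<phi> \<subseteq> prefix_vars Q"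
    using assms(1) by (simp_all add: ssat_formula_def)
  have "substs (map snd ([] :: 'v prefix)) \<tau> \<phi> = \<phi>" for \<tau>
    by (simp add: substs_def)
  \<comment> \<open>With the whole prefix still remaining there are no outer variables, which forces
    the clause to be empty.\<close>
  then obtain c where "s_resolution Q \<phi> c (ssat_prob Q \<phi>)" "clause_vars c \<subseteq> prefix_vars []"
    using s_resolution_restricted[OF Q assms(2) append_Nil[symmetric]] by metis
  then show ?thesis
    using assms(4) by (simp add: prefix_vars_def clause_vars_def)
qed

end
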